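(* Let $n\geq 4$ and let $G$ be the $(n^2,3(n-1),n,6)$-SRG associated with an orthogonal array $OA(3,n)$. Then $$\kappa_2(G)=2k-\lambda-2=5n-8,$$ where $k=3(n-1)$ and $\lambda=n$. Moreover, every disconnecting set $S$ of $G$ of size $5n-8$ such that every component of $G\setminus S$ has at least two vertices is of the form $N(\{u,v\})$, where $u$ and $v$ are two adjacent vertices of $G$, or (up to permuting the rows of the array and permuting the symbols within a row) of the form $N(A)$, where $A=\{[1,x_i,y_i]^t\}_{1\leq i\leq 4}$ induces a clique of order $4$.
   Context: An orthogonal array $OA(3,n)$ is a $3\times n^2$ matrix with entries from $[n]=\{1,\dots,n\}$ such that for any two distinct rows, the $n^2$ ordered pairs they define (one for each column) are all distinct. The associated graph $G$ has as vertices the $n^2$ columns of the array, two distinct columns being adjacent if they have the same entry in some coordinate position. It is a $(v,k,\lambda,\mu)=(n^2,3(n-1),n,6)$-SRG: $v$ vertices, $k$-regular, adjacent vertices have exactly $\lambda$ common neighbors, distinct non-adjacent vertices have exactly $\mu$ common neighbors. $[x,y,z]^t$ denotes the column with entries $x,y,z$. For $X\subset V(G)$, $N(X)=\{y\notin X: y\sim x\text{ for some }x\in X\}$. A disconnecting set of a connected graph $G$ is a set $S$ of vertices such that $G\setminus S$ is disconnected. $\kappa_2(G)$ denotes the minimum size of a disconnecting set $S$ of $G$ such that every component of $G\setminus S$ has at least two vertices. *)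

theory Defs
  imports "Graph_Theory.Digraph_Component" "Jordan_Normal_Form.Matrix"
begin

text \<open>
  Simple graphs are symmetric loop-free digraphs, as in the session Graph\_Theory. For such graphs
  the members of \<^const>\<open>pre_digraph.sccs\<close> are the connected components.
\<close>

definition is_srg :: "('a, 'b) pre_digraph \<Rightarrow> nat \<Rightarrow> nat \<Rightarrow> nat \<Rightarrow> nat \<Rightarrow> bool" where
  "is_srg G v k lam mu \<longleftrightarrow> graph G \<and> card (verts G) = v \<and>
     (\<forall>x\<in>verts G. card {z \<in> verts G. x \<rightarrow>\<^bsub>G\<^esub> z} = k) \<and>
     (\<forall>x\<in>verts G. \<forall>y\<in>verts G. x \<rightarrow>\<^bsub>G\<^esub> y \<longrightarrow>
        card {z \<in> verts G. x \<rightarrow>\<^bsub>G\<^esub> z \<and> y \<rightarrow>\<^bsub>G\<^esub> z} = lam) \<and>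
     (\<forall>x\<in>verts G. \<forall>y\<in>verts G. x \<noteq> y \<and> \<not> x \<rightarrow>\<^bsub>G\<^esub> y \<longrightarrow>
        card {z \<in> verts G. x \<rightarrow>\<^bsub>G\<^esub> z \<and> y \<rightarrow>\<^bsub>G\<^esub> z} = mu)"

definition nbhd :: "('a, 'b) pre_digraph \<Rightarrow> 'a set \<Rightarrow> 'a set" where
  "nbhd G X = {y \<in> verts G - X. \<exists>x\<in>X. x \<rightarrow>\<^bsub>G\<^esub> y}"

definition induces_clique :: "('a, 'b) pre_digraph \<Rightarrow> 'a set \<Rightarrow> bool" where
  "induces_clique G X \<longleftrightarrow> X \<subseteq> verts G \<and> (\<forall>x\<in>X. \<forall>y\<in>X. x \<noteq> y \<longrightarrow> x \<rightarrow>\<^bsub>G\<^esub> y)"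

text \<open>
  The inclusion is strict because the empty graph, which does not satisfy
  \<^const>\<open>Digraph_Component.connected\<close>, is not to count as disconnected.
\<close>
definition disconnecting_set :: "('a, 'b) pre_digraph \<Rightarrow> 'a set \<Rightarrow> bool" where
  "disconnecting_set G S \<longleftrightarrow>
     S \<subset> verts G \<and> \<not> Digraph_Component.connected (G \<restriction> (verts G - S))"

definition disconnecting_set2 :: "('a, 'b) pre_digraph \<Rightarrow> 'a set \<Rightarrow> bool" where
  "disconnecting_set2 G S \<longleftrightarrow> disconnecting_set G S \<and>
     (\<forall>C\<in>pre_digraph.sccs (G \<restriction> (verts G - S)). card (verts C) \<ge> 2)"

text \<open>
  On natural numbers \<^const>\<open>Inf\<close> is the minimum of a nonempty set, and 0 for the empty set. So a
  positive value of \<open>kappa2 G\<close> is attained (a disconnecting set of a connected graph is nonempty).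
\<close>
definition kappa2 :: "('a, 'b) pre_digraph \<Rightarrow> nat" where
  "kappa2 G = Inf (card ` {S. disconnecting_set2 G S})"

text \<open>
  Matrix positions are counted from 0, as in the session Jordan\_Normal\_Form; the symbols are
  \<open>1, \<dots>, n\<close>.
\<close>
definition orthogonal_array3 :: "nat \<Rightarrow> nat mat \<Rightarrow> bool" where
  "orthogonal_array3 n M \<longleftrightarrow> M \<in> carrier_mat 3 (n\<^sup>2) \<and> elements_mat M \<subseteq> {1..n} \<and>
     (\<forall>r<3. \<forall>s<3. r \<noteq> s \<longrightarrow> inj_on (\<lambda>c. (M $$ (r, c), M $$ (s, c))) {..<n\<^sup>2})"

definition oa_graph :: "nat mat \<Rightarrow> (nat vec, nat vec \<times> nat vec) pre_digraph" where
  "oa_graph M = \<lparr> verts = set (cols M),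
     arcs = {(u, v). u \<in> set (cols M) \<and> v \<in> set (cols M) \<and> u \<noteq> v \<and>
                     (\<exists>i<dim_row M. u $ i = v $ i)},
     tail = fst, head = snd \<rparr>"

lemma three_cases: "(r::nat) < 3 \<longleftrightarrow> r = 0 \<or> r = 1 \<or> r = 2"
  by auto

context
  fixes n :: nat and M :: "nat mat"
  assumes OA: "orthogonal_array3 n M"
begin

lemma oa_dims: "dim_row M = 3" "dim_col M = n\<^sup>2"
  using OA by (auto simp: orthogonal_array3_def)

lemma oa_col:
  assumes "v \<in> set (cols M)"
  obtains j where "j < n\<^sup>2" "v = col M j" "\<And>i. i < 3 \<Longrightarrow> v $ i = M $$ (i, j)"
  using assms oa_dims by (auto simp: cols_def)

lemma oa_entry:
  assumes "v \<in> set (cols M)" "i < 3"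
  shows "v $ i \<in> {1..n}"
proof -
  obtain j where "j < n\<^sup>2" "v $ i = M $$ (i, j)"
    using assms by (metis oa_col)
  moreover have "M \<in> carrier_mat 3 (n\<^sup>2)" "elements_mat M \<subseteq> {1..n}"
    using OA by (auto simp: orthogonal_array3_def)
  ultimately show ?thesis
    using assms(2) elements_matI by blast
qed

lemma oa_eq:
  assumes "u \<in> set (cols M)" "v \<in> set (cols M)" "r < 3" "s < 3" "r \<noteq> s" "u $ r = v $ r" "u $ s = v $ s"
  shows "u = v"
proof -
  obtain j where j: "j < n\<^sup>2" "u = col M j" "\<And>i. i < 3 \<Longrightarrow> u $ i = M $$ (i, j)"
    using assms(1) oa_col by blast
  obtain k where k: "k < n\<^sup>2" "v = col M k" "\<And>i. i < 3 \<Longrightarrow> v $ i = M $$ (i, k)"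
    using assms(2) oa_col by blast
  have "inj_on (\<lambda>c. (M $$ (r, c), M $$ (s, c))) {..<n\<^sup>2}"
    using OA assms by (auto simp: orthogonal_array3_def)
  then have "j = k"
    using j k assms by (auto simp: inj_on_def)
  then show ?thesis using j k by simp
qed

lemma oa_card: "card (set (cols M)) = n\<^sup>2"
proof -
  have "inj_on (col M) {0..<n\<^sup>2}"
  proof (rule inj_onI)
    fix j k assume jk: "j \<in> {0..<n\<^sup>2}" "k \<in> {0..<n\<^sup>2}" "col M j = col M k"
    have "M $$ (i, j) = M $$ (i, k)" if "i < 3" for i
      using jk that oa_dims by (metis atLeastLessThan_iff index_col)
    moreover have "inj_on (\<lambda>c. (M $$ (0, c), M $$ (1, c))) {..<n\<^sup>2}"
      using OA by (auto simp: orthogonal_array3_def)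
    ultimately show "j = k"
      using jk by (auto simp: inj_on_def)
  qed
  moreover have "set (cols M) = col M ` {0..<n\<^sup>2}"
    by (simp add: cols_def oa_dims)
  ultimately show ?thesis by (simp add: card_image)
qed

lemma oa_ex:
  assumes "r < 3" "s < 3" "r \<noteq> s" "a \<in> {1..n}" "b \<in> {1..n}"
  shows "\<exists>w\<in>set (cols M). w $ r = a \<and> w $ s = b"
proof -
  let ?f = "\<lambda>v. (v $ r, v $ s)"
  have "inj_on ?f (set (cols M))"
    using assms by (auto intro!: inj_onI intro: oa_eq)
  then have "card (?f ` set (cols M)) = card ({1..n} \<times> {1..n})"
    by (simp add: card_image oa_card card_cartesian_product power2_eq_square)
  moreover have "?f ` set (cols M) \<subseteq> {1..n} \<times> {1..n}"
    using assms oa_entry by blast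
  ultimately have "?f ` set (cols M) = {1..n} \<times> {1..n}"
    by (intro card_subset_eq) auto
  then have "(a, b) \<in> ?f ` set (cols M)" using assms by blast
  then show ?thesis by auto
qed

lemma oa_line:
  assumes "r < 3" "a \<in> {1..n}"
  shows "card {v \<in> set (cols M). v $ r = a} = n"
proof -
  obtain s where s: "s < (3::nat)" "s \<noteq> r"
    by (metis one_less_numeral_iff semiring_norm(77) zero_less_numeral zero_neq_one)
  let ?L = "{v \<in> set (cols M). v $ r = a}"
  have "inj_on (\<lambda>v. v $ s) ?L"
    using assms s by (auto intro!: inj_onI intro: oa_eq[of _ _ r s])
  moreover have "(\<lambda>v. v $ s) ` ?L = {1..n}"
  proof
    show "(\<lambda>v. v $ s) ` ?L \<subseteq> {1..n}" using s oa_entry by blast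
    show "{1..n} \<subseteq> (\<lambda>v. v $ s) ` ?L"
    proof
      fix b assume "b \<in> {1..n}"
      then obtain w where "w \<in> set (cols M)" "w $ r = a" "w $ s = b"
        using oa_ex[of r s a b] assms s by auto
      then show "b \<in> (\<lambda>v. v $ s) ` ?L" by (auto intro!: image_eqI[of _ _ w])
    qed
  qed
  ultimately show ?thesis using card_image by fastforce
qed

lemma oa_adj:
  "u \<rightarrow>\<^bsub>oa_graph M\<^esub> v \<longleftrightarrow>
     u \<in> set (cols M) \<and> v \<in> set (cols M) \<and> u \<noteq> v \<and> (\<exists>i<3. u $ i = v $ i)"
  by (force simp: arcs_ends_def arc_to_ends_def oa_graph_def oa_dims)

lemma oa_graph_graph: "graph (oa_graph M)"
proof -
  have "arcs (oa_graph M) \<subseteq> set (cols M) \<times> set (cols M)"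
    by (auto simp: oa_graph_def)
  then have "finite (arcs (oa_graph M))"
    by (rule finite_subset) simp
  then show ?thesis
    by unfold_locales
      (auto simp: oa_graph_def arc_to_ends_def symmetric_def sym_def arcs_ends_def image_iff)
qed

lemma oa_degree:
  assumes u: "u \<in> set (cols M)"
  shows "card {z \<in> set (cols M). u \<rightarrow>\<^bsub>oa_graph M\<^esub> z} = 3 * (n - 1)"
proof -
  let ?L = "\<lambda>r. {v \<in> set (cols M). v $ r = u $ r} - {u}"
  have "{z \<in> set (cols M). u \<rightarrow>\<^bsub>oa_graph M\<^esub> z} = (\<Union>r\<in>{..<3}. ?L r)"
    using u by (auto simp: oa_adj)
  also have "card \<dots> = (\<Sum>r<3. card (?L r))"
  proof (rule card_UN_disjoint)
    show "\<forall>i\<in>{..<3}. \<forall>j\<in>{..<3}. i \<noteq> j \<longrightarrow> ?L i \<inter> ?L j = {}"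
      using u by (auto dest: oa_eq)
  qed auto
  also have "\<dots> = (\<Sum>r<(3::nat). n - 1)"
    by (rule sum.cong) (use u oa_line oa_entry in auto)
  finally show ?thesis by simp
qed

lemma oa_lambda:
  assumes uv: "u \<rightarrow>\<^bsub>oa_graph M\<^esub> v"
  shows "card {z \<in> set (cols M). u \<rightarrow>\<^bsub>oa_graph M\<^esub> z \<and> v \<rightarrow>\<^bsub>oa_graph M\<^esub> z} = n"
proof -
  have u: "u \<in> set (cols M)" and v: "v \<in> set (cols M)" and "u \<noteq> v"
    using uv by (auto simp: oa_adj)
  obtain r where r: "r < 3" "u $ r = v $ r" using uv by (auto simp: oa_adj)
  obtain s t where st: "s < 3" "t < 3" "s \<noteq> r" "t \<noteq> r" "s \<noteq> t" 
    and cases: "\<And>i. i < 3 \<longleftrightarrow> i = r \<or> i = s \<or> i = t"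
  proof -
    consider "r = 0" | "r = 1" | "r = 2" using r by linarith
    then show ?thesis
      by cases (rule that[of 1 2] that[of 0 2] that[of 0 1]; auto)+
  qed
  have s: "u $ s \<noteq> v $ s" and t: "u $ t \<noteq> v $ t"
    using oa_eq[OF u v r(1) _ _ r(2)] st \<open>u \<noteq> v\<close> by metis+
  obtain p where p: "p \<in> set (cols M)" "p $ s = u $ s" "p $ t = v $ t"
    using oa_ex[of s t "u $ s" "v $ t"] oa_entry u v st by blast
  obtain q where q: "q \<in> set (cols M)" "q $ s = v $ s" "q $ t = u $ t"
    using oa_ex[of s t "v $ s" "u $ t"] oa_entry u v st by blast
  let ?L = "{w \<in> set (cols M). w $ r = u $ r}"
  have pr: "p $ r \<noteq> u $ r"
    using oa_eq[OF p(1) u r(1) st(1)] p(2,3) st(3) t by metis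
  have qr: "q $ r \<noteq> u $ r"
    using oa_eq[OF q(1) u r(1) st(2)] q(2,3) st(4) s by metis
  have pq: "p \<noteq> q" using p q s by auto
  have ne: "p \<noteq> u" "p \<noteq> v" "q \<noteq> u" "q \<noteq> v" using p q s t by auto
  have "{z \<in> set (cols M). u \<rightarrow>\<^bsub>oa_graph M\<^esub> z \<and> v \<rightarrow>\<^bsub>oa_graph M\<^esub> z} = (?L - {u, v}) \<union> {p, q}"
    (is "?A = ?B")
  proof
    show "?A \<subseteq> ?B"
    proof
      fix z assume "z \<in> ?A"
      then have z: "z \<in> set (cols M)" "z \<noteq> u" "z \<noteq> v"
        and "\<exists>i<3. u $ i = z $ i" "\<exists>i<3. v $ i = z $ i" by (auto simp: oa_adj)
      then have "z $ r = u $ r \<or> (z $ s = u $ s \<and> z $ t = v $ t) \<or> (z $ s = v $ s \<and> z $ t = u $ t)"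
        using r s t unfolding cases by metis
      then show "z \<in> ?B"
        using z oa_eq[OF z(1) p(1) st(1,2,5)] oa_eq[OF z(1) q(1) st(1,2,5)] p q by auto
    qed
    show "?B \<subseteq> ?A"
      using u v p q ne r st by (auto simp: oa_adj)
  qed
  moreover have "card ?B = n"
  proof -
    have L: "card ?L = n" by (rule oa_line[OF r(1) oa_entry[OF u r(1)]])
    have sub: "{u, v} \<subseteq> ?L" using u v r by auto
    have "card {u, v} \<le> card ?L" by (rule card_mono[OF _ sub]) simp
    then have "2 \<le> n" using L \<open>u \<noteq> v\<close> by simp
    moreover have "card (?L - {u, v}) = n - 2"
      using sub L \<open>u \<noteq> v\<close> by (simp add: card_Diff_subset)
    moreover have "card ((?L - {u, v}) \<union> {p, q}) = card (?L - {u, v}) + card {p, q}"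
      by (rule card_Un_disjoint) (use pr qr in auto)
    ultimately show ?thesis using pq by simp
  qed
  ultimately show ?thesis by simp
qed

lemma oa_mu:
  assumes u: "u \<in> set (cols M)" and v: "v \<in> set (cols M)" and "u \<noteq> v"
    and nadj: "\<not> u \<rightarrow>\<^bsub>oa_graph M\<^esub> v"
  shows "card {z \<in> set (cols M). u \<rightarrow>\<^bsub>oa_graph M\<^esub> z \<and> v \<rightarrow>\<^bsub>oa_graph M\<^esub> z} = 6"
proof -
  have d: "u $ i \<noteq> v $ i" if "i < 3" for i
    using assms that by (auto simp: oa_adj)
  let ?K = "{(0,1), (0,2), (1,0), (1,2), (2,0), (2,1)} :: (nat \<times> nat) set"
  have K: "(i, j) \<in> ?K \<longleftrightarrow> i < 3 \<and> j < 3 \<and> i \<noteq> j" for i j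
    by (auto simp: three_cases)
  let ?P = "\<lambda>ij w. w \<in> set (cols M) \<and> w $ fst ij = u $ fst ij \<and> w $ snd ij = v $ snd ij"
  have "\<forall>ij\<in>?K. \<exists>w. ?P ij w"
  proof
    fix ij assume "ij \<in> ?K"
    then show "\<exists>w. ?P ij w"
      using oa_ex[of "fst ij" "snd ij" "u $ fst ij" "v $ snd ij"] K[of "fst ij" "snd ij"]
        oa_entry u v by (metis prod.collapse)
  qed
  then obtain f where "\<forall>ij\<in>?K. ?P ij (f ij)" by (rule bchoice[THEN exE])
  then have f: "f (i, j) \<in> set (cols M)" "f (i, j) $ i = u $ i" "f (i, j) $ j = v $ j"
    if "i < 3" "j < 3" "i \<noteq> j" for i j
    using K[of i j] that by auto
  have "inj_on f ?K"
  proof (rule inj_onI)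
    fix a b assume ab: "a \<in> ?K" "b \<in> ?K" "f a = f b"
    obtain i j where a: "a = (i, j)" by (cases a)
    obtain i' j' where b: "b = (i', j')" by (cases b)
    have ij: "i < 3" "j < 3" "i \<noteq> j" "i' < 3" "j' < 3" "i' \<noteq> j'"
      using ab K a b by auto
    have "i = i'"
      using oa_eq[OF f(1)[OF ij(1-3)] u ij(1) ij(4)] f[OF ij(1-3)] f[OF ij(4-6)] ab(3) d[OF ij(2)] a b
      by metis
    moreover have "j = j'"
      using oa_eq[OF f(1)[OF ij(1-3)] v ij(2) ij(5)] f[OF ij(1-3)] f[OF ij(4-6)] ab(3) d[OF ij(1)] a b
      by metis
    ultimately show "a = b" using a b by simp
  qed
  then have "card (f ` ?K) = 6" by (subst card_image) auto
  moreover have "{z \<in> set (cols M). u \<rightarrow>\<^bsub>oa_graph M\<^esub> z \<and> v \<rightarrow>\<^bsub>oa_graph M\<^esub> z} = f ` ?K"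
    (is "?A = _")
  proof
    show "?A \<subseteq> f ` ?K"
    proof
      fix z assume "z \<in> ?A"
      then obtain i j where z: "z \<in> set (cols M)" and
        ij: "i < 3" "u $ i = z $ i" "j < 3" "v $ j = z $ j" by (auto simp: oa_adj)
      then have "i \<noteq> j" using d by metis
      then have "z = f (i, j)"
        using oa_eq[OF z f(1)[of i j], of i j] f(2,3)[of i j] ij by auto
      then show "z \<in> f ` ?K" using K[of i j] ij \<open>i \<noteq> j\<close> by blast
    qed
    show "f ` ?K \<subseteq> ?A"
    proof
      fix z assume "z \<in> f ` ?K"
      then obtain i j where z: "z = f (i, j)" and "(i, j) \<in> ?K"
        by (elim imageE) (metis prod.collapse)
      then have ij: "i < 3" "j < 3" "i \<noteq> j" using K by blast+
      have "u \<noteq> z" "v \<noteq> z" using f[OF ij] z d ij by metis+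
      moreover have "u $ i = z $ i" "v $ j = z $ j" using f[OF ij] z by auto
      ultimately show "z \<in> ?A"
        using f(1)[OF ij] z ij u v by (auto simp only: oa_adj mem_Collect_eq)
    qed
  qed
  ultimately show ?thesis by simp
qed

lemma oa_graph_is_srg: "is_srg (oa_graph M) (n\<^sup>2) (3 * (n - 1)) n 6"
proof -
  have "verts (oa_graph M) = set (cols M)" by (simp add: oa_graph_def)
  then show ?thesis
    by (simp add: is_srg_def oa_graph_graph oa_card oa_degree oa_lambda oa_mu)
qed

lemma oa_graph_connected:
  assumes "n > 0"
  shows "Digraph_Component.connected (oa_graph M)"
proof -
  interpret graph "oa_graph M" by (rule oa_graph_graph)
  have V: "verts (oa_graph M) = set (cols M)" by (simp add: oa_graph_def)
  have "u \<rightarrow>\<^sup>*\<^bsub>oa_graph M\<^esub> v" if u: "u \<in> set (cols M)" and v: "v \<in> set (cols M)" for u v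
  proof -
    obtain w where w: "w \<in> set (cols M)" "w $ 0 = u $ 0" "w $ 1 = v $ 1"
      using oa_ex[of 0 1 "u $ 0" "v $ 1"] oa_entry u v by auto
    have "u = w \<or> u \<rightarrow>\<^bsub>oa_graph M\<^esub> w" "w = v \<or> w \<rightarrow>\<^bsub>oa_graph M\<^esub> v"
      using u v w by (auto simp: oa_adj three_cases)
    then show ?thesis
      using u v w V by (metis reachable_adjI reachable_refl reachable_trans)
  qed
  moreover have "set (cols M) \<noteq> {}"
    using oa_card assms by force
  ultimately have "strongly_connected (oa_graph M)"
    by (auto simp: V strongly_connected_def)
  then show ?thesis
    by (simp add: connected_def strongly_connected_def reachable_mk_symmetric_eq[OF sym_arcs])
qed

end

text \<open>
  The effect on a column of a permutation \<open>\<pi>\<close> of the rows of an array followed by a permutation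
  \<open>\<sigma> i\<close> of the symbols in each row \<open>i\<close>.
\<close>
definition relabel_col :: "(nat \<Rightarrow> nat) \<Rightarrow> (nat \<Rightarrow> nat \<Rightarrow> nat) \<Rightarrow> nat vec \<Rightarrow> nat vec" where
  "relabel_col \<pi> \<sigma> v = vec (dim_vec v) (\<lambda>i. \<sigma> i (v $ \<pi> i))"

end

theory Submission
  imports Defs
begin

text \<open>
  Suppose \<open>G - S\<close> splits into parts \<open>A\<close>, \<open>B\<close> without edges between them, and let \<open>r\<close>, \<open>c\<close>, \<open>z\<close> be
  the numbers of symbols that \<open>A\<close> uses in the three rows of the array. The symbols used by \<open>B\<close> lie
  in the complements, so by inclusion--exclusion
  \<open>|A| + |B| \<le> n\<^sup>2 - n (r + c + z) + r c + r z + c z\<close>, i.e. \<open>|S| \<ge> h := n (r + c + z) - r c - r z - c z\<close>.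
  As \<open>A\<close> and \<open>B\<close> both contain an edge, at least two of \<open>r\<close>, \<open>c\<close>, \<open>z\<close> are at least 2 and at least
  two are at most \<open>n - 2\<close>. Since \<open>h\<close> is affine in each variable, its minimum is attained at a corner
  of this region; it is \<open>5n - 8\<close>, and for \<open>n \<ge> 5\<close> it is attained only if \<open>A\<close> or \<open>B\<close> is a single
  edge. For \<open>n = 4\<close> a set \<open>S\<close> of size 12 leaves only four vertices, so again \<open>A\<close> is an edge. Hence
  every extremal \<open>S\<close> is the neighbourhood of an edge: the first alternative always holds.

  For \<open>n \<ge> 5\<close> the neighbourhood of every edge is extremal. For \<open>n = 4\<close> one needs two opposite
  edges with no edge between them; these come from an intercalate of the Latin square.
\<close>

section \<open>Disconnecting sets as edge-free splittings; neighbourhoods of edges\<close>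

lemma adj_induce_iff:
  "x \<rightarrow>\<^bsub>G \<restriction> W\<^esub> y \<longleftrightarrow> x \<rightarrow>\<^bsub>G\<^esub> y \<and> x \<in> W \<and> y \<in> W"
  by (auto simp: arcs_ends_def arc_to_ends_def)

text \<open>Components are traded for a splitting into two parts: all components have at least two
  vertices exactly when no vertex outside \<open>S\<close> becomes isolated, and this can be read
  off inside \<open>A\<close> and \<open>B\<close> separately.\<close>

lemma disconnecting_set2_iff:
  assumes "graph G"
  shows "disconnecting_set2 G S \<longleftrightarrow> S \<subseteq> verts G \<and>
    (\<exists>A B. A \<union> B = verts G - S \<and> A \<inter> B = {} \<and> A \<noteq> {} \<and> B \<noteq> {} \<and>
      (\<forall>x\<in>A. \<forall>y\<in>B. \<not> x \<rightarrow>\<^bsub>G\<^esub> y) \<and>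
      (\<forall>x\<in>A. \<exists>y\<in>A. x \<rightarrow>\<^bsub>G\<^esub> y) \<and> (\<forall>x\<in>B. \<exists>y\<in>B. x \<rightarrow>\<^bsub>G\<^esub> y))"
    (is "_ \<longleftrightarrow> _ \<and> ?split")
proof (cases "S \<subseteq> verts G")
  case False
  then show ?thesis by (auto simp: disconnecting_set2_def disconnecting_set_def)
next
  case True
  interpret G: graph G by fact
  define W where "W = verts G - S"
  define H where "H = G \<restriction> W"
  have VH: "verts H = W" by (simp add: H_def)
  have adjH: "x \<rightarrow>\<^bsub>H\<^esub> y \<longleftrightarrow> x \<rightarrow>\<^bsub>G\<^esub> y \<and> x \<in> W \<and> y \<in> W" for x y
    by (simp add: H_def adj_induce_iff)
  have "induced_subgraph H G" by (auto simp: H_def W_def)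
  then interpret H: graph H
    by (intro graph.intro pseudo_graph.intro G.digraphI_induced G.induced_graph_imp_graph
        digraph.axioms(1))
  \<comment> \<open>\<open>connected\<close> refers to the symmetric closure; in a symmetric graph
    this is plain reachability.\<close>
  have conn: "connected H \<longleftrightarrow> W \<noteq> {} \<and> (\<forall>u\<in>W. \<forall>v\<in>W. u \<rightarrow>\<^sup>*\<^bsub>H\<^esub> v)"
    by (simp add: connected_def strongly_connected_def
        H.reachable_mk_symmetric_eq[OF H.sym_arcs] VH)
  have symG: "y \<rightarrow>\<^bsub>G\<^esub> x" if "x \<rightarrow>\<^bsub>G\<^esub> y" for x y using that by (rule G.graph_symmetric)
  have ne: "S \<noteq> verts G \<longleftrightarrow> W \<noteq> {}" using True by (auto simp: W_def)
  show ?thesis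
  proof
    assume "disconnecting_set2 G S"
    then have nc: "\<not> connected H" and "S \<noteq> verts G"
      and c2: "\<forall>C\<in>H.sccs. card (verts C) \<ge> 2"
      by (auto simp: disconnecting_set2_def disconnecting_set_def H_def W_def)
    then obtain u v where uv: "u \<in> W" "v \<in> W" "\<not> u \<rightarrow>\<^sup>*\<^bsub>H\<^esub> v"
      using conn ne by blast
    \<comment> \<open>The component of \<open>u\<close> is one part, the rest of \<open>W\<close>
      the other; \<open>v\<close> keeps the latter nonempty.\<close>
    define A where "A = {w. u \<rightarrow>\<^sup>*\<^bsub>H\<^esub> w}"
    have uA: "u \<in> A" using uv VH by (auto simp: A_def)
    have AW: "A \<subseteq> W" using VH by (auto simp: A_def dest: H.reachable_in_verts)
    have cl: "y \<in> A" if "x \<in> A" "x \<rightarrow>\<^bsub>H\<^esub> y" for x y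
      using that by (auto simp: A_def intro: H.reachable_adj_trans)
    \<comment> \<open>A vertex without neighbours would be a component of size 1.\<close>
    have nb: "\<exists>y. x \<rightarrow>\<^bsub>H\<^esub> y" if "x \<in> W" for x
    proof (rule ccontr)
      assume no: "\<nexists>y. x \<rightarrow>\<^bsub>H\<^esub> y"
      have "{v. x \<rightarrow>\<^sup>*\<^bsub>H\<^esub> v} = {x}"
        using no that VH by (auto elim: H.converse_reachable_cases)
      moreover have "H \<restriction> {v. x \<rightarrow>\<^sup>*\<^bsub>H\<^esub> v} \<in> H.sccs"
        using that VH by (intro H.induce_reachable_is_in_sccs) simp
      ultimately have "2 \<le> card {x}" using c2 by fastforce
      then show False by simp
    qed
    have nbA: "\<exists>y\<in>A. x \<rightarrow>\<^bsub>G\<^esub> y" if "x \<in> A" for x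
      using nb[of x] cl[OF that] AW that by (auto simp: adjH)
    have noAB: "\<not> x \<rightarrow>\<^bsub>G\<^esub> y" if "x \<in> A" "y \<in> W - A" for x y
      using cl[of x y] that AW by (auto simp: adjH)
    have nbB: "\<exists>y\<in>W - A. x \<rightarrow>\<^bsub>G\<^esub> y" if "x \<in> W - A" for x
      using nb[of x] that noAB[of _ x] symG[of x] unfolding adjH by blast
    have "A \<union> (W - A) = verts G - S" "A \<inter> (W - A) = {}" using AW by (auto simp: W_def)
    moreover have "A \<noteq> {}" "W - A \<noteq> {}" using uA uv by (auto simp: A_def)
    moreover have "\<forall>x\<in>A. \<forall>y\<in>W - A. \<not> x \<rightarrow>\<^bsub>G\<^esub> y" by (intro ballI noAB)
    moreover have "\<forall>x\<in>A. \<exists>y\<in>A. x \<rightarrow>\<^bsub>G\<^esub> y" by (intro ballI nbA)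
    moreover have "\<forall>x\<in>W - A. \<exists>y\<in>W - A. x \<rightarrow>\<^bsub>G\<^esub> y" by (intro ballI nbB)
    ultimately have ?split
      by (intro exI[of _ A] exI[of _ "W - A"] conjI)
    with True show "S \<subseteq> verts G \<and> ?split" by (rule conjI)
  next
    assume "S \<subseteq> verts G \<and> ?split"
    then obtain A B where AB: "A \<union> B = W" "A \<inter> B = {}" "A \<noteq> {}" "B \<noteq> {}"
      and no: "\<forall>x\<in>A. \<forall>y\<in>B. \<not> x \<rightarrow>\<^bsub>G\<^esub> y"
      and nb: "\<forall>x\<in>A. \<exists>y\<in>A. x \<rightarrow>\<^bsub>G\<^esub> y" "\<forall>x\<in>B. \<exists>y\<in>B. x \<rightarrow>\<^bsub>G\<^esub> y"
      unfolding W_def by (elim conjE exE)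
    obtain a b where a: "a \<in> A" and b: "b \<in> B" using AB by blast
    have "y \<in> A" if "a \<rightarrow>\<^sup>*\<^bsub>H\<^esub> y" for y
      using that
    proof (induction rule: H.reachable_induct)
      case base show ?case by (rule a)
    next
      case (step x y)
      then show ?case using no AB by (auto simp: adjH)
    qed
    then have nc: "\<not> connected H" using a b AB conn by blast
    \<comment> \<open>A vertex \<open>x\<close> of the component has a neighbour \<open>y\<close> in
      its own part; by symmetry they are mutually reachable, so \<open>C\<close> contains
      both.\<close>
    have "card (verts C) \<ge> 2" if C: "C \<in> H.sccs" for C
    proof -
      have CV: "verts C \<in> H.sccs_verts" using C by (simp add: H.sccs_verts_conv)
      then obtain x where x: "x \<in> verts C" by (auto simp: H.sccs_verts_def)
      have "x \<in> W" using CV x VH by (meson H.sccs_verts_subsets subsetD)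
      then obtain y where y: "y \<in> W" "x \<rightarrow>\<^bsub>G\<^esub> y" using nb AB by blast
      then have xy: "x \<rightarrow>\<^bsub>H\<^esub> y" "y \<rightarrow>\<^bsub>H\<^esub> x" using \<open>x \<in> W\<close> symG by (auto simp: adjH)
      then have "y \<in> verts C"
        using CV x xy[THEN H.reachable_adjI] unfolding H.in_sccs_verts_conv_reachable by metis
      moreover have "x \<noteq> y" using y(2) G.adj_not_same by blast
      moreover have "finite (verts C)"
        using H.sccs_verts_subsets[OF CV] by (rule finite_subset) simp
      ultimately show ?thesis
        using card_mono[of "verts C" "{x, y}"] x by auto
    qed
    with nc True ne AB show "disconnecting_set2 G S"
      by (auto simp: disconnecting_set2_def disconnecting_set_def H_def W_def)
  qed
qed

text \<open>Inclusion-exclusion for the neighbourhoods of \<open>u\<close> and \<open>w\<close>,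
  whose union also contains \<open>u\<close> and \<open>w\<close> themselves. The additive form
  avoids truncated subtraction.\<close>

lemma card_nbhd_edge:
  assumes srg: "is_srg G v k lam mu" and uw: "u \<rightarrow>\<^bsub>G\<^esub> w"
  shows "card (nbhd G {u, w}) + lam + 2 = 2 * k"
proof -
  interpret G: graph G using srg by (simp add: is_srg_def)
  let ?N = "\<lambda>x. {z \<in> verts G. x \<rightarrow>\<^bsub>G\<^esub> z}"
  have V: "u \<in> verts G" "w \<in> verts G" "u \<noteq> w" and wu: "w \<rightarrow>\<^bsub>G\<^esub> u"
    using uw G.adj_not_same G.graph_symmetric by auto
  have "card (?N u) = k" "card (?N w) = k" "card (?N u \<inter> ?N w) = lam"
    using srg V uw by (auto simp: is_srg_def Int_def conj_ac)
  then have "card (?N u \<union> ?N w) + lam = 2 * k"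
    using card_Un_Int[of "?N u" "?N w"] by simp
  moreover have "?N u \<union> ?N w = nbhd G {u, w} \<union> {u, w}"
    using V uw wu by (auto simp: nbhd_def)
  moreover have "card (nbhd G {u, w} \<union> {u, w}) = card (nbhd G {u, w}) + card {u, w}"
    by (rule card_Un_disjoint) (auto simp: nbhd_def)
  ultimately show ?thesis using V by simp
qed

section \<open>An integer inequality for three symbol counts\<close>

text \<open>\<open>K\<close> is the value of \<open>h\<close> at \<open>r = 1\<close>. Its excess
  over \<open>5 * n - 8\<close> is a sum of two products of nonnegative factors; since
  \<open>n - 1 - z\<close> and \<open>n - 3\<close> are at least 1, it vanishes only for
  \<open>c = z = 2\<close>.\<close>

lemma net_bound_one:
  fixes n c z :: int
  assumes n: "n \<ge> 4" and c: "2 \<le> c" and z: "2 \<le> z" "z \<le> n - 2"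
  defines "K \<equiv> n + (n - 1) * (c + z) - c * z"
  shows "5 * n - 8 \<le> K" and "K = 5 * n - 8 \<Longrightarrow> c = 2 \<and> z = 2"
proof -
  have K: "K - (5 * n - 8) = (c - 2) * (n - 1 - z) + (z - 2) * (n - 3)"
    by (simp add: K_def algebra_simps)
  have "c - 2 \<le> (c - 2) * (n - 1 - z)" "z - 2 \<le> (z - 2) * (n - 3)"
    using mult_left_mono[of 1 "n - 1 - z" "c - 2"] mult_left_mono[of 1 "n - 3" "z - 2"] n c z
    by simp_all
  then show "5 * n - 8 \<le> K" and "K = 5 * n - 8 \<Longrightarrow> c = 2 \<and> z = 2"
    using K c z by auto
qed

text \<open>\<open>h\<close> is affine in \<open>r\<close> with slope \<open>n - (c + z)\<close>, so
  it is minimal at \<open>r = 1\<close> or at \<open>r = n - 1\<close>. Replacing each variable by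
  its difference from \<open>n\<close> leaves \<open>h\<close> unchanged, which turns the second end
  into the first.\<close>

lemma net_bound_box:
  fixes n r c z :: int
  assumes n: "n \<ge> 4" and r: "1 \<le> r" "r \<le> n - 1" and c: "2 \<le> c" "c \<le> n - 2"
    and z: "2 \<le> z" "z \<le> n - 2"
  defines "h \<equiv> n * (r + c + z) - (r * c + r * z + c * z)"
  shows "5 * n - 8 \<le> h \<and>
    (n \<ge> 5 \<and> h = 5 * n - 8 \<longrightarrow> r * c \<le> 2 \<or> (n - r) * (n - c) \<le> 2)"
proof (cases "c + z \<le> n")
  case True
  define K where "K = n + (n - 1) * (c + z) - c * z"
  have K: "5 * n - 8 \<le> K" "K = 5 * n - 8 \<Longrightarrow> c = 2 \<and> z = 2"
    unfolding K_def by (rule net_bound_one; use n c z in simp)+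
  have h: "h = K + (r - 1) * (n - (c + z))" by (simp add: h_def K_def algebra_simps)
  have pos: "0 \<le> (r - 1) * (n - (c + z))" using True r by simp
  \<comment> \<open>Equality forces \<open>c = z = 2\<close>; for \<open>n \<ge> 5\<close> the slope
    \<open>n - 4\<close> is then positive, so \<open>r = 1\<close>.\<close>
  moreover have "r * c \<le> 2" if "n \<ge> 5" "h = 5 * n - 8"
  proof -
    have "K = 5 * n - 8" "(r - 1) * (n - (c + z)) = 0" using h pos K(1) that by linarith+
    then show ?thesis using K(2) that by auto
  qed
  ultimately show ?thesis using h K(1) by auto
next
  case False
  define K where "K = n + (n - 1) * ((n - c) + (n - z)) - (n - c) * (n - z)"
  have K: "5 * n - 8 \<le> K" "K = 5 * n - 8 \<Longrightarrow> n - c = 2 \<and> n - z = 2"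
    unfolding K_def by (rule net_bound_one; use n c z in simp)+
  have h: "h = K + (n - 1 - r) * (c + z - n)" by (simp add: h_def K_def algebra_simps)
  have pos: "0 \<le> (n - 1 - r) * (c + z - n)" using False r by simp
  moreover have "(n - r) * (n - c) \<le> 2" if "n \<ge> 5" "h = 5 * n - 8"
  proof -
    have "K = 5 * n - 8" "(n - 1 - r) * (c + z - n) = 0" using h pos K(1) that by linarith+
    then have "n - c = 2" "r = n - 1" using K(2) that False by auto
    then show ?thesis by simp
  qed
  ultimately show ?thesis using h K(1) by auto
qed

text \<open>At the corner \<open>r = 1\<close>, \<open>c = n - 1\<close> the value of
  \<open>h\<close> is independent of \<open>z\<close> and exceeds the bound by the square of
  \<open>n - 3\<close>.\<close>

lemma net_bound_corner:
  fixes n z :: int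
  assumes "n \<ge> 4"
  shows "5 * n - 8 < n * (1 + (n - 1) + z) - (1 * (n - 1) + 1 * z + (n - 1) * z)"
proof -
  have "n * (1 + (n - 1) + z) - (1 * (n - 1) + 1 * z + (n - 1) * z) - (5 * n - 8) = (n - 3) * (n - 3)"
    by (simp add: algebra_simps)
  moreover have "0 < (n - 3) * (n - 3)" using assms by simp
  ultimately show ?thesis by linarith
qed

text \<open>Unless \<open>r = 1\<close> and \<open>c = n - 1\<close>, one of \<open>r\<close> and
  \<open>c\<close> lies between 2 and \<open>n - 2\<close>, as \<open>z\<close> does, and
  \<open>net_bound_box\<close> applies with the other as its free variable.\<close>

lemma net_bound_pair:
  fixes n r c z :: int
  assumes n: "n \<ge> 4" and r: "1 \<le> r" "r \<le> n - 2" and c: "2 \<le> c" "c \<le> n - 1"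
    and z: "2 \<le> z" "z \<le> n - 2"
  defines "h \<equiv> n * (r + c + z) - (r * c + r * z + c * z)"
  shows "5 * n - 8 \<le> h \<and>
    (n \<ge> 5 \<and> h = 5 * n - 8 \<longrightarrow> r * c \<le> 2 \<or> (n - r) * (n - c) \<le> 2)"
proof -
  consider "c \<le> n - 2" | "2 \<le> r" | "r = 1" "c = n - 1" using r c by linarith
  then show ?thesis
  proof cases
    case 1
    then show ?thesis unfolding h_def using assms by (intro net_bound_box) auto
  next
    case 2
    have h: "h = n * (c + r + z) - (c * r + c * z + r * z)" by (simp add: h_def algebra_simps)
    have "5 * n - 8 \<le> h \<and> (n \<ge> 5 \<and> h = 5 * n - 8 \<longrightarrow> c * r \<le> 2 \<or> (n - c) * (n - r) \<le> 2)"
      unfolding h using n r c z 2 by (intro net_bound_box) auto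
    then show ?thesis unfolding mult.commute[of r c] mult.commute[of "n - r" "n - c"] .
  next
    case 3
    then show ?thesis using net_bound_corner[OF n, of z] by (simp add: h_def)
  qed
qed

text \<open>\<open>lo\<close> and \<open>hi\<close> each single out two of the three variables. If
  the pairs coincide, \<open>net_bound_box\<close> applies; otherwise they share one variable and
  \<open>net_bound_pair\<close> applies. The symmetry of \<open>h\<close> covers all nine
  combinations.\<close>

lemma net_bound:
  fixes n r c z :: int
  assumes n: "n \<ge> 4"
    and rng: "1 \<le> r" "r \<le> n - 1" "1 \<le> c" "c \<le> n - 1" "1 \<le> z" "z \<le> n - 1"
    and lo: "2 \<le> r \<and> 2 \<le> c \<or> 2 \<le> r \<and> 2 \<le> z \<or> 2 \<le> c \<and> 2 \<le> z"
    and hi: "r \<le> n - 2 \<and> c \<le> n - 2 \<or> r \<le> n - 2 \<and> z \<le> n - 2 \<or> c \<le> n - 2 \<and> z \<le> n - 2"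
  defines "h \<equiv> n * (r + c + z) - (r * c + r * z + c * z)"
  shows "5 * n - 8 \<le> h \<and> (n \<ge> 5 \<and> h = 5 * n - 8 \<longrightarrow>
    r * c \<le> 2 \<or> r * z \<le> 2 \<or> c * z \<le> 2 \<or>
    (n - r) * (n - c) \<le> 2 \<or> (n - r) * (n - z) \<le> 2 \<or> (n - c) * (n - z) \<le> 2)"
proof -
  \<comment> \<open>\<open>perm x y w\<close> records what survives a reordering of
    \<open>r\<close>, \<open>c\<close>, \<open>z\<close>: the value of \<open>h\<close>, and that
    both products occur in the conclusion.\<close>
  define perm where "perm x y w \<longleftrightarrow>
      h = n * (x + y + w) - (x * y + x * w + y * w) \<and>
      x * y \<in> {r * c, r * z, c * z} \<and>
      (n - x) * (n - y) \<in> {(n - r) * (n - c), (n - r) * (n - z), (n - c) * (n - z)}"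
    for x y w
  have box: ?thesis
    if "perm x y w" "1 \<le> x" "x \<le> n - 1" "2 \<le> y" "y \<le> n - 2" "2 \<le> w" "w \<le> n - 2" for x y w
    using net_bound_box[OF n that(2-)] that(1) unfolding perm_def by auto
  \<comment> \<open>Here \<open>w\<close> is the variable in both pairs, \<open>y\<close> occurs
    only in \<open>lo\<close> and \<open>x\<close> only in \<open>hi\<close>.\<close>
  have pair: ?thesis
    if "perm x y w" "1 \<le> x" "x \<le> n - 2" "2 \<le> y" "y \<le> n - 1" "2 \<le> w" "w \<le> n - 2" for x y w
    using net_bound_pair[OF n that(2-)] that(1) unfolding perm_def by auto
  have perm: "perm r c z" "perm r z c" "perm c r z" "perm c z r" "perm z r c" "perm z c r"
    by (simp_all add: perm_def h_def algebra_simps)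
  show ?thesis
    using lo
  proof (elim disjE)
    assume lo: "2 \<le> r \<and> 2 \<le> c"
    show ?thesis
      using hi
    proof (elim disjE)
      assume "r \<le> n - 2 \<and> c \<le> n - 2"
      with lo show ?thesis using rng by (intro box[OF perm(5)]) linarith+
    next
      assume "r \<le> n - 2 \<and> z \<le> n - 2"
      with lo show ?thesis using rng by (intro pair[OF perm(6)]) linarith+
    next
      assume "c \<le> n - 2 \<and> z \<le> n - 2"
      with lo show ?thesis using rng by (intro pair[OF perm(5)]) linarith+
    qed
  next
    assume lo: "2 \<le> r \<and> 2 \<le> z"
    show ?thesis
      using hi
    proof (elim disjE)
      assume "r \<le> n - 2 \<and> c \<le> n - 2"
      with lo show ?thesis using rng by (intro pair[OF perm(4)]) linarith+
    next
      assume "r \<le> n - 2 \<and> z \<le> n - 2"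
      with lo show ?thesis using rng by (intro box[OF perm(3)]) linarith+
    next
      assume "c \<le> n - 2 \<and> z \<le> n - 2"
      with lo show ?thesis using rng by (intro pair[OF perm(3)]) linarith+
    qed
  next
    assume lo: "2 \<le> c \<and> 2 \<le> z"
    show ?thesis
      using hi
    proof (elim disjE)
      assume "r \<le> n - 2 \<and> c \<le> n - 2"
      with lo show ?thesis using rng by (intro pair[OF perm(2)]) linarith+
    next
      assume "r \<le> n - 2 \<and> z \<le> n - 2"
      with lo show ?thesis using rng by (intro pair[OF perm(1)]) linarith+
    next
      assume "c \<le> n - 2 \<and> z \<le> n - 2"
      with lo show ?thesis using rng by (intro box[OF perm(1)]) linarith+
    qed
  qed
qed

section \<open>Counting columns by their symbols\<close>

text \<open>With counts as sums of indicators, inclusion-exclusion can be checked one column at a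
  time.\<close>

lemma card_eq_sum_of_bool:
  assumes "finite V"
  shows "int (card {v \<in> V. P v}) = (\<Sum>v\<in>V. of_bool (P v))"
  using assms by (simp add: of_bool_def sum.If_cases Int_def)

text \<open>Any two rows identify the columns with all pairs of symbols.\<close>

lemma oa_card_box2:
  assumes "orthogonal_array3 n M" "r < 3" "s < 3" "r \<noteq> s" "X \<subseteq> {1..n}" "Y \<subseteq> {1..n}"
  shows "card {v \<in> set (cols M). v $ r \<in> X \<and> v $ s \<in> Y} = card X * card Y"
proof -
  let ?D = "{v \<in> set (cols M). v $ r \<in> X \<and> v $ s \<in> Y}"
  have "bij_betw (\<lambda>v. (v $ r, v $ s)) ?D (X \<times> Y)"
    unfolding bij_betw_def
  proof
    show "inj_on (\<lambda>v. (v $ r, v $ s)) ?D"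
      using assms by (auto intro!: inj_onI intro: oa_eq)
    show "(\<lambda>v. (v $ r, v $ s)) ` ?D = X \<times> Y"
    proof
      show "X \<times> Y \<subseteq> (\<lambda>v. (v $ r, v $ s)) ` ?D"
      proof clarify
        fix a b assume ab: "a \<in> X" "b \<in> Y"
        then obtain w where "w \<in> set (cols M)" "w $ r = a" "w $ s = b"
          using oa_ex[OF assms(1-4), of a b] assms(5,6) by blast
        then show "(a, b) \<in> (\<lambda>v. (v $ r, v $ s)) ` ?D"
          using ab by (auto intro!: image_eqI[of _ _ w])
      qed
    qed auto
  qed
  then show ?thesis by (simp add: bij_betw_same_card card_cartesian_product)
qed

lemma oa_card_box1:
  assumes "orthogonal_array3 n M" "r < 3" "X \<subseteq> {1..n}"
  shows "card {v \<in> set (cols M). v $ r \<in> X} = n * card X"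
proof -
  obtain s where s: "s < (3::nat)" "r \<noteq> s"
    by (metis one_less_numeral_iff semiring_norm(77) zero_less_numeral zero_neq_one)
  have "{v \<in> set (cols M). v $ r \<in> X} = {v \<in> set (cols M). v $ r \<in> X \<and> v $ s \<in> {1..n}}"
    using oa_entry[OF assms(1) _ s(1)] by blast
  then show ?thesis using oa_card_box2[OF assms(1,2) s assms(3), of "{1..n}"] by simp
qed

text \<open>For three truth values, the indicators of "all" and "none" add up to 1 minus the single
  indicators plus the pairwise ones. The triple intersection, which depends on the array, cancels;
  the remaining counts involve at most two rows.\<close>

lemma oa_card_box3_add_card_compl:
  assumes oa: "orthogonal_array3 n M" and X: "\<And>i. i < 3 \<Longrightarrow> X i \<subseteq> {1..n}"
  defines "x \<equiv> \<lambda>i. int (card (X i))"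
  shows "int (card {v \<in> set (cols M). \<forall>i<3. v $ i \<in> X i}) +
      int (card {v \<in> set (cols M). \<forall>i<3. v $ i \<notin> X i}) =
    int n ^ 2 - int n * (x 0 + x 1 + x 2) + (x 0 * x 1 + x 0 * x 2 + x 1 * x 2)"
proof -
  let ?V = "set (cols M)"
  let ?c = "\<lambda>P. (\<Sum>v\<in>?V. of_bool (P v)) :: int"
  have c: "?c P = int (card {v \<in> ?V. P v})" for P
    by (rule card_eq_sum_of_bool[symmetric]) simp
  have one: "?c (\<lambda>v. v $ i \<in> X i) = int n * x i" if "i < 3" for i
    using oa_card_box1[OF oa that X[OF that]] by (simp add: c x_def)
  have two: "?c (\<lambda>v. v $ i \<in> X i \<and> v $ j \<in> X j) = x i * x j" if "i < 3" "j < 3" "i \<noteq> j" for i j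
    using oa_card_box2[OF oa that X X] that by (simp add: c x_def)
  have idx: "(0::nat) < 3" "(1::nat) < 3" "(2::nat) < 3" "(0::nat) \<noteq> 1" "(0::nat) \<noteq> 2" "(1::nat) \<noteq> 2"
    by simp_all
  have all: "?c (\<lambda>v. True) = int n ^ 2"
    using oa_card[OF oa] by simp
  have "?c (\<lambda>v. \<forall>i<3. v $ i \<in> X i) + ?c (\<lambda>v. \<forall>i<3. v $ i \<notin> X i) =
    (\<Sum>v\<in>?V. of_bool True -
      (of_bool (v $ 0 \<in> X 0) + of_bool (v $ 1 \<in> X 1) + of_bool (v $ 2 \<in> X 2)) +
      (of_bool (v $ 0 \<in> X 0 \<and> v $ 1 \<in> X 1) + of_bool (v $ 0 \<in> X 0 \<and> v $ 2 \<in> X 2) +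
       of_bool (v $ 1 \<in> X 1 \<and> v $ 2 \<in> X 2)))"
    unfolding sum.distrib[symmetric]
    by (rule sum.cong) (auto simp: three_cases)
  also have "\<dots> = int n ^ 2 - int n * (x 0 + x 1 + x 2) + (x 0 * x 1 + x 0 * x 2 + x 1 * x 2)"
    unfolding sum.distrib sum_subtractf all
      one[OF idx(1)] one[OF idx(2)] one[OF idx(3)]
      two[OF idx(1,2) idx(4)] two[OF idx(1,3) idx(5)] two[OF idx(2,3) idx(6)]
    by (simp only: distrib_left)
  finally show ?thesis by (simp add: c)
qed

text \<open>Distinct columns agree in at most one row, so the ends of an edge, agreeing in row
  \<open>r\<close>, differ in the other two.\<close>

lemma oa_edge_card_coords:
  assumes oa: "orthogonal_array3 n M" and uv: "u \<rightarrow>\<^bsub>oa_graph M\<^esub> v"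
    and X: "u \<in> X" "v \<in> X" "finite X"
  obtains r where "r < 3" "\<And>i. i < 3 \<Longrightarrow> i \<noteq> r \<Longrightarrow> 2 \<le> card ((\<lambda>v. v $ i) ` X)"
proof -
  obtain r where r: "r < 3" "u $ r = v $ r" and V: "u \<in> set (cols M)" "v \<in> set (cols M)" "u \<noteq> v"
    using uv by (auto simp: oa_adj[OF oa])
  have "2 \<le> card ((\<lambda>v. v $ i) ` X)" if i: "i < 3" "i \<noteq> r" for i
  proof -
    have "u $ i \<noteq> v $ i" using oa_eq[OF oa V(1,2) r(1) i(1)] i r V by auto
    then have "2 = card ((\<lambda>v. v $ i) ` {u, v})" by simp
    also have "\<dots> \<le> card ((\<lambda>v. v $ i) ` X)" using X by (intro card_mono) auto
    finally show ?thesis .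
  qed
  with r(1) show thesis by (rule that)
qed

text \<open>\<open>A\<close> lies in the box spanned by its symbols in rows \<open>i\<close> and
  \<open>j\<close>. In the equality case a small product thus forces a part to be a single
  edge.\<close>

lemma oa_card_le_coords:
  assumes oa: "orthogonal_array3 n M" and ij: "i < 3" "j < 3" "i \<noteq> j" and A: "A \<subseteq> set (cols M)"
  shows "card A \<le> card ((\<lambda>v. v $ i) ` A) * card ((\<lambda>v. v $ j) ` A)"
proof -
  let ?X = "\<lambda>i. (\<lambda>v. v $ i) ` A"
  have "?X i \<subseteq> {1..n}" "?X j \<subseteq> {1..n}" using oa_entry[OF oa] A ij by blast+
  then have "card {v \<in> set (cols M). v $ i \<in> ?X i \<and> v $ j \<in> ?X j} = card (?X i) * card (?X j)"
    by (intro oa_card_box2[OF oa ij])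
  moreover have "card A \<le> card {v \<in> set (cols M). v $ i \<in> ?X i \<and> v $ j \<in> ?X j}"
    using A by (intro card_mono) auto
  ultimately show ?thesis by simp
qed

section \<open>The lower bound and its equality case\<close>

lemma oa_disconnecting_set2_bound:
  assumes oa: "orthogonal_array3 n M" and n: "n \<ge> 4" and D: "disconnecting_set2 (oa_graph M) S"
  shows "5 * n - 8 \<le> card S \<and>
    (card S = 5 * n - 8 \<longrightarrow> (\<exists>u v. u \<rightarrow>\<^bsub>oa_graph M\<^esub> v \<and> S = nbhd (oa_graph M) {u, v}))"
proof -
  let ?G = "oa_graph M" and ?V = "set (cols M)"
  interpret G: graph ?G by (rule oa_graph_graph[OF oa])
  have VG: "verts ?G = ?V" by (simp add: oa_graph_def)
  from D obtain A B where SV: "S \<subseteq> ?V" and AB: "A \<union> B = ?V - S" "A \<inter> B = {}" "A \<noteq> {}" "B \<noteq> {}"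
    and nos: "\<forall>x\<in>A. \<forall>y\<in>B. \<not> x \<rightarrow>\<^bsub>?G\<^esub> y"
    and nbA: "\<forall>x\<in>A. \<exists>y\<in>A. x \<rightarrow>\<^bsub>?G\<^esub> y" and nbB: "\<forall>x\<in>B. \<exists>y\<in>B. x \<rightarrow>\<^bsub>?G\<^esub> y"
    unfolding disconnecting_set2_iff[OF oa_graph_graph[OF oa]] VG by (elim conjE exE)
  have no: "\<not> x \<rightarrow>\<^bsub>?G\<^esub> y" if "x \<in> A" "y \<in> B" for x y using nos that by blast
  have fin: "finite A" "finite B" "finite S" and sub: "A \<subseteq> ?V" "B \<subseteq> ?V"
    using AB(1) SV finite_subset[of _ ?V] by auto
  have no': "\<not> y \<rightarrow>\<^bsub>?G\<^esub> x" if "x \<in> A" "y \<in> B" for x y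
    using no[OF that] G.graph_symmetric[of y x] by blast
  obtain a a' where a: "a \<in> A" "a' \<in> A" "a \<rightarrow>\<^bsub>?G\<^esub> a'" using AB(3) nbA by blast
  obtain b b' where b: "b \<in> B" "b' \<in> B" "b \<rightarrow>\<^bsub>?G\<^esub> b'" using AB(4) nbB by blast
  have ne: "a \<noteq> a'" "b \<noteq> b'" using a b G.adj_not_same by blast+
  have cS: "card S + card A + card B = n\<^sup>2"
  proof -
    have "card (A \<union> B) = card A + card B" using fin AB(2) by (intro card_Un_disjoint) auto
    moreover have "card (?V - S) = card ?V - card S" using SV fin by (intro card_Diff_subset) auto
    moreover have "card S \<le> card ?V" using SV by (intro card_mono) auto
    ultimately show ?thesis using AB(1) oa_card[OF oa] by simp
  qed

  define X where "X i = (\<lambda>v. v $ i) ` A" for i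
  define Y where "Y i = (\<lambda>v. v $ i) ` B" for i
  define x where "x i = int (card (X i))" for i
  have Xn: "X i \<subseteq> {1..n}" and Yn: "Y i \<subseteq> {1..n}" if "i < 3" for i
    using oa_entry[OF oa _ that] sub unfolding X_def Y_def by blast+
  \<comment> \<open>A symbol shared in row \<open>i\<close> would make a column of \<open>A\<close>
    equal or adjacent to one of \<open>B\<close>.\<close>
  have disj: "X i \<inter> Y i = {}" if "i < 3" for i
  proof (rule ccontr)
    assume "X i \<inter> Y i \<noteq> {}"
    then obtain v w where "v \<in> A" "w \<in> B" "v $ i = w $ i" by (auto simp: X_def Y_def)
    then show False using no[of v w] AB(2) sub that by (auto simp: oa_adj[OF oa])
  qed
  have XY: "x i + int (card (Y i)) \<le> int n" if "i < 3" for i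
  proof -
    have f: "finite (X i)" "finite (Y i)" using fin by (auto simp: X_def Y_def)
    have "card (X i \<union> Y i) \<le> card {1..n}" using Xn Yn that by (intro card_mono) auto
    then show ?thesis using card_Un_disjoint[OF f disj[OF that]] by (simp add: x_def)
  qed
  have rng: "1 \<le> x i" "x i \<le> int n - 1" if "i < 3" for i
  proof -
    have "card (X i) \<noteq> 0" "card (Y i) \<noteq> 0" using AB fin by (simp_all add: X_def Y_def)
    then show "1 \<le> x i" "x i \<le> int n - 1" using XY[OF that] by (simp_all add: x_def)
  qed
  \<comment> \<open>Each part contains an edge, so it uses at least two symbols in all rows but one;
    for \<open>B\<close> this leaves at most \<open>n - 2\<close> symbols to \<open>A\<close>
    there.\<close>
  obtain r where r: "r < 3" "\<And>i. i < 3 \<Longrightarrow> i \<noteq> r \<Longrightarrow> 2 \<le> card (X i)"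
    using oa_edge_card_coords[OF oa a(3,1,2) fin(1)] unfolding X_def by blast
  obtain s where s: "s < 3" "\<And>i. i < 3 \<Longrightarrow> i \<noteq> s \<Longrightarrow> 2 \<le> card (Y i)"
    using oa_edge_card_coords[OF oa b(3,1,2) fin(2)] unfolding Y_def by blast
  have xr: "2 \<le> x i" if "i < 3" "i \<noteq> r" for i using r(2)[OF that] by (simp add: x_def)
  have xs: "x i \<le> int n - 2" if "i < 3" "i \<noteq> s" for i using s(2)[OF that] XY[OF that(1)] by simp
  have lo: "2 \<le> x 0 \<and> 2 \<le> x 1 \<or> 2 \<le> x 0 \<and> 2 \<le> x 2 \<or> 2 \<le> x 1 \<and> 2 \<le> x 2"
    using xr[of 0] xr[of 1] xr[of 2] r(1) by (cases "r = 0"; cases "r = 1") auto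
  have hi: "x 0 \<le> int n - 2 \<and> x 1 \<le> int n - 2 \<or> x 0 \<le> int n - 2 \<and> x 2 \<le> int n - 2 \<or>
      x 1 \<le> int n - 2 \<and> x 2 \<le> int n - 2"
    using xs[of 0] xs[of 1] xs[of 2] s(1) by (cases "s = 0"; cases "s = 1") auto
  define h where "h = int n * (x 0 + x 1 + x 2) - (x 0 * x 1 + x 0 * x 2 + x 1 * x 2)"
  define small where "small \<longleftrightarrow> x 0 * x 1 \<le> 2 \<or> x 0 * x 2 \<le> 2 \<or> x 1 * x 2 \<le> 2 \<or>
    (int n - x 0) * (int n - x 1) \<le> 2 \<or> (int n - x 0) * (int n - x 2) \<le> 2 \<or>
    (int n - x 1) * (int n - x 2) \<le> 2"
  have h: "5 * int n - 8 \<le> h" and h_eq: "n \<ge> 5 \<Longrightarrow> h = 5 * int n - 8 \<Longrightarrow> small"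
    using net_bound[of "int n" "x 0" "x 1" "x 2"] n rng lo hi unfolding h_def small_def by auto

  \<comment> \<open>Columns of \<open>A\<close> take all their symbols from the sets
    \<open>X i\<close>, columns of \<open>B\<close> none, so together they number at most
    \<open>n * n - h\<close>.\<close>
  have "h \<le> int (card S)"
  proof -
    have "card A \<le> card {v \<in> ?V. \<forall>i<3. v $ i \<in> X i}"
      using sub by (intro card_mono) (auto simp: X_def)
    moreover have "card B \<le> card {v \<in> ?V. \<forall>i<3. v $ i \<notin> X i}"
    proof (intro card_mono subsetI CollectI conjI allI impI)
      show "v $ i \<notin> X i" if "v \<in> B" "i < 3" for v i
        using disj[OF that(2)] that(1) by (auto simp: Y_def)
    qed (use sub in auto)
    moreover have "int (card S) + int (card A) + int (card B) = int n ^ 2"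
      using arg_cong[OF cS, of int] by simp
    ultimately show ?thesis
      using oa_card_box3_add_card_compl[OF oa, of X] Xn by (simp add: h_def x_def)
  qed
  then have low: "5 * n - 8 \<le> card S" using h by linarith
  have ext: "\<exists>u v. u \<rightarrow>\<^bsub>?G\<^esub> v \<and> S = nbhd ?G {u, v}" if eq: "card S = 5 * n - 8"
  proof -
    have size: "card A \<le> 2 \<or> card B \<le> 2"
    proof (cases "n \<ge> 5")
      case True
      have "small" using h_eq[OF True] h \<open>h \<le> int (card S)\<close> eq n by simp
      have A_le: "card A \<le> 2" if "x i * x j \<le> 2" "i < 3" "j < 3" "i \<noteq> j" for i j
      proof -
        have "int (card A) \<le> x i * x j"
          using oa_card_le_coords[OF oa that(2-) sub(1)]
          by (simp add: x_def X_def flip: of_nat_mult)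
        then show ?thesis using that(1) by linarith
      qed
      have B_le: "card B \<le> 2"
        if "(int n - x i) * (int n - x j) \<le> 2" "i < 3" "j < 3" "i \<noteq> j" for i j
      proof -
        have "int (card B) \<le> int (card (Y i)) * int (card (Y j))"
          using oa_card_le_coords[OF oa that(2-) sub(2)] by (simp add: Y_def flip: of_nat_mult)
        also have "\<dots> \<le> (int n - x i) * (int n - x j)"
          using XY[of i] XY[of j] that(2,3) rng[of i] by (intro mult_mono) auto
        finally show ?thesis using that(1) by linarith
      qed
      have idx: "(0::nat) < 3" "(1::nat) < 3" "(2::nat) < 3" "(0::nat) \<noteq> 1" "(0::nat) \<noteq> 2" "(1::nat) \<noteq> 2"
        by simp_all
      from \<open>small\<close> show ?thesis
        unfolding small_def
      proof (elim disjE)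
        assume "x 0 * x 1 \<le> 2" from A_le[OF this idx(1,2,4)] show ?thesis ..
      next
        assume "x 0 * x 2 \<le> 2" from A_le[OF this idx(1,3,5)] show ?thesis ..
      next
        assume "x 1 * x 2 \<le> 2" from A_le[OF this idx(2,3,6)] show ?thesis ..
      next
        assume "(int n - x 0) * (int n - x 1) \<le> 2" from B_le[OF this idx(1,2,4)] show ?thesis ..
      next
        assume "(int n - x 0) * (int n - x 2) \<le> 2" from B_le[OF this idx(1,3,5)] show ?thesis ..
      next
        assume "(int n - x 1) * (int n - x 2) \<le> 2" from B_le[OF this idx(2,3,6)] show ?thesis ..
      qed
    next
      case False
      then have "n = 4" using n by simp
      \<comment> \<open>Of 16 columns, 12 lie in \<open>S\<close>.\<close>
      then have "card A + card B = 4" using cS eq by simp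
      then show ?thesis by linarith
    qed
    have nA: "nbhd ?G A \<subseteq> S"
    proof
      fix y assume "y \<in> nbhd ?G A"
      then obtain x where "x \<in> A" "x \<rightarrow>\<^bsub>?G\<^esub> y" "y \<in> ?V - A" by (auto simp: nbhd_def VG)
      moreover from this no[of x y] have "y \<notin> B" by auto
      ultimately show "y \<in> S" using AB(1) by blast
    qed
    have nB: "nbhd ?G B \<subseteq> S"
    proof
      fix y assume "y \<in> nbhd ?G B"
      then obtain x where "x \<in> B" "x \<rightarrow>\<^bsub>?G\<^esub> y" "y \<in> ?V - B" by (auto simp: nbhd_def VG)
      moreover from this no'[of y x] have "y \<notin> A" by auto
      ultimately show "y \<in> S" using AB(1) by blast
    qed
    have eqA: "{a, a'} = A" if "card A \<le> 2"
      by (rule card_seteq[OF fin(1)]) (use a ne that in simp_all)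
    have eqB: "{b, b'} = B" if "card B \<le> 2"
      by (rule card_seteq[OF fin(2)]) (use b ne that in simp_all)
    \<comment> \<open>A part with at most two vertices is the edge chosen in it; its neighbourhood
      misses the other part and so lies in \<open>S\<close>.\<close>
    obtain u v where uv: "u \<rightarrow>\<^bsub>?G\<^esub> v" and sub_S: "nbhd ?G {u, v} \<subseteq> S"
      using size
    proof (elim disjE)
      assume "card A \<le> 2"
      then show thesis using that[OF a(3)] nA by (simp only: eqA)
    next
      assume "card B \<le> 2"
      then show thesis using that[OF b(3)] nB by (simp only: eqB)
    qed
    \<comment> \<open>Both sizes are \<open>5 * n - 8\<close>, so the inclusion is an
      equality.\<close>
    have "card (nbhd ?G {u, v}) = card S"
      using card_nbhd_edge[OF oa_graph_is_srg[OF oa] uv] eq n by simp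
    then have "nbhd ?G {u, v} = S" by (rule card_subset_eq[OF fin(3) sub_S])
    then show ?thesis using uv by (intro exI[of _ u] exI[of _ v]) simp
  qed
  show ?thesis by (intro conjI impI low ext)
qed

section \<open>Sets attaining the bound\<close>

text \<open>
  Applied to a line \<open>L\<close> of an array on four symbols, with \<open>f x y\<close> the first entry of the column that
  agrees with \<open>x\<close> in the second and with \<open>y\<close> in the third position: a symmetric pair is an intercalate.
\<close>

lemma four_point_symmetric_pair:
  fixes f :: "'a \<Rightarrow> 'a \<Rightarrow> nat"
  assumes L: "card L = 4"
    and f: "\<And>x y. x \<in> L \<Longrightarrow> y \<in> L \<Longrightarrow> x \<noteq> y \<Longrightarrow> f x y \<in> {2..4}"
    and row: "\<And>x y z. x \<in> L \<Longrightarrow> y \<in> L \<Longrightarrow> z \<in> L \<Longrightarrow> x \<noteq> y \<Longrightarrow> x \<noteq> z \<Longrightarrow> y \<noteq> z \<Longrightarrow> f x y \<noteq> f x z"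
    and col: "\<And>x y z. x \<in> L \<Longrightarrow> y \<in> L \<Longrightarrow> z \<in> L \<Longrightarrow> x \<noteq> y \<Longrightarrow> x \<noteq> z \<Longrightarrow> y \<noteq> z \<Longrightarrow> f y x \<noteq> f z x"
  obtains x y where "x \<in> L" "y \<in> L" "x \<noteq> y" "f x y = f y x"
proof (rule ccontr)
  assume "\<not> thesis"
  then have asym: "\<And>x y. x \<in> L \<Longrightarrow> y \<in> L \<Longrightarrow> x \<noteq> y \<Longrightarrow> f x y \<noteq> f y x" using that by blast
  obtain a b c d where L4: "L = {a, b, c, d}" and
    ne: "a \<noteq> b" "a \<noteq> c" "a \<noteq> d" "b \<noteq> c" "b \<noteq> d" "c \<noteq> d"
    using L by (auto simp: card_Suc_eq numeral_eq_Suc)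
  have v: "f x y = 2 \<or> f x y = 3 \<or> f x y = 4" if "x \<in> L" "y \<in> L" "x \<noteq> y" for x y
    using f[OF that] by auto
  have inL: "a \<in> L" "b \<in> L" "c \<in> L" "d \<in> L" using L4 by auto
  have "f a b \<noteq> f b a" "f a c \<noteq> f c a" "f a d \<noteq> f d a" "f b c \<noteq> f c b" "f b d \<noteq> f d b" "f c d \<noteq> f d c"
    by (rule asym; use inL ne in simp)+
  moreover have "f a b \<noteq> f a c" "f a b \<noteq> f a d" "f a c \<noteq> f a d"
    "f b a \<noteq> f b c" "f b a \<noteq> f b d" "f b c \<noteq> f b d"
    "f c a \<noteq> f c b" "f c a \<noteq> f c d" "f c b \<noteq> f c d"
    "f d a \<noteq> f d b" "f d a \<noteq> f d c" "f d b \<noteq> f d c"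
    by (rule row; use inL ne in simp)+
  moreover have "f b a \<noteq> f c a" "f b a \<noteq> f d a" "f c a \<noteq> f d a"
    "f a b \<noteq> f c b" "f a b \<noteq> f d b" "f c b \<noteq> f d b"
    "f a c \<noteq> f b c" "f a c \<noteq> f d c" "f b c \<noteq> f d c"
    "f a d \<noteq> f b d" "f a d \<noteq> f c d" "f b d \<noteq> f c d"
    by (rule col; use inL ne in simp)+
  moreover note v[OF inL(1,2) ne(1)] v[OF inL(1,3) ne(2)] v[OF inL(1,4) ne(3)]
    v[OF inL(2,1) ne(1)[symmetric]] v[OF inL(2,3) ne(4)] v[OF inL(2,4) ne(5)]
    v[OF inL(3,1) ne(2)[symmetric]] v[OF inL(3,2) ne(4)[symmetric]] v[OF inL(3,4) ne(6)]
    v[OF inL(4,1) ne(3)[symmetric]] v[OF inL(4,2) ne(5)[symmetric]] v[OF inL(4,3) ne(6)[symmetric]]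
  \<comment> \<open>Each value of \<open>f\<close> defines a fixed-point-free permutation of the
    four points. If one is a 4-cycle, the other two are its inverse and its square, and the square
    is symmetric; otherwise all are double transpositions. The finite case analysis is left to the
    solver.\<close>
  ultimately show False by smt
qed

text \<open>The neighbourhood of an edge is removed. Each column of the rest \<open>B\<close> keeps
  a neighbour in \<open>B\<close>, because its line in row 1 has \<open>n \<ge> 5\<close> columns,
  of which at most three are outside \<open>B\<close>.\<close>

lemma oa_ex_disconnecting_set2_ge5:
  assumes oa: "orthogonal_array3 n M" and n: "n \<ge> 5"
  shows "\<exists>S. disconnecting_set2 (oa_graph M) S \<and> card S = 5 * n - 8"
proof -
  let ?G = "oa_graph M" and ?V = "set (cols M)"
  interpret G: graph ?G by (rule oa_graph_graph[OF oa])
  have VG: "verts ?G = ?V" by (simp add: oa_graph_def)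
  have ex: "\<exists>w\<in>?V. w $ 0 = 1 \<and> w $ 1 = a" if "a \<in> {1..n}" for a
    using n that by (intro oa_ex[OF oa]) auto
  obtain u where u: "u \<in> ?V" "u $ 0 = 1" "u $ 1 = 1" using ex[of 1] n by auto
  have "\<exists>w\<in>?V. w $ 0 = 1 \<and> w $ 1 = 2" using n by (intro ex) simp
  then obtain v where v: "v \<in> ?V" "v $ 0 = 1" "v $ 1 = 2" by blast
  have uv: "u \<rightarrow>\<^bsub>?G\<^esub> v" using u v by (auto simp: oa_adj[OF oa] three_cases)
  define S where "S = nbhd ?G {u, v}"
  define B where "B = ?V - S - {u, v}"
  have cS: "card S = 5 * n - 8"
    using card_nbhd_edge[OF oa_graph_is_srg[OF oa] uv] n by (simp add: S_def)
  have SV: "S \<subseteq> ?V" by (auto simp: S_def nbhd_def VG)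
  have B_iff: "b \<in> B \<longleftrightarrow> b \<in> ?V \<and> (\<forall>i<3. b $ i \<noteq> u $ i) \<and> (\<forall>i<3. b $ i \<noteq> v $ i)" for b
  proof -
    have adj_or: "b = w \<or> w \<rightarrow>\<^bsub>?G\<^esub> b \<longleftrightarrow> (\<exists>i<3. b $ i = w $ i)" if "b \<in> ?V" "w \<in> ?V" for w
      using that unfolding oa_adj[OF oa] by (metis zero_less_numeral)
    have "b \<in> B \<longleftrightarrow> b \<in> ?V \<and> \<not> (b = u \<or> u \<rightarrow>\<^bsub>?G\<^esub> b) \<and> \<not> (b = v \<or> v \<rightarrow>\<^bsub>?G\<^esub> b)"
      by (auto simp: B_def S_def nbhd_def VG)
    then show ?thesis using adj_or u(1) v(1) by blast
  qed
  \<comment> \<open>\<open>S\<close> and the edge have at most \<open>5 * n - 6\<close> columns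
    together, fewer than \<open>n * n\<close>.\<close>
  have "B \<noteq> {}"
  proof
    assume "B = {}"
    then have "?V = S \<union> {u, v}" using SV u v by (auto simp: B_def)
    then have "card ?V \<le> card S + card {u, v}" by (metis card_Un_le)
    moreover have "card {u, v} \<le> 2" by (simp add: card_insert_if)
    moreover have "5 * n \<le> n * n" using n by simp
    ultimately show False using cS n oa_card[OF oa] unfolding power2_eq_square by linarith
  qed
  have nb: "\<exists>w\<in>B. b \<rightarrow>\<^bsub>?G\<^esub> w" if b: "b \<in> B" for b
  proof (rule ccontr)
    assume no: "\<not> (\<exists>w\<in>B. b \<rightarrow>\<^bsub>?G\<^esub> w)"
    have bV: "b \<in> ?V" "b $ 1 \<noteq> u $ 1" "b $ 1 \<noteq> v $ 1" using b by (auto simp: B_iff)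
    have e: "b $ 1 \<in> {1..n}" "u $ 2 \<in> {1..n}" "v $ 2 \<in> {1..n}"
      using oa_entry[OF oa] bV u v by auto
    \<comment> \<open>\<open>p\<close>, \<open>q\<close>, \<open>t\<close> are the columns of this
      line that meet \<open>u\<close> or \<open>v\<close> in another row; a single \<open>p\<close>
      serves both, as they share the first entry 1.\<close>
    obtain p where p: "p \<in> ?V" "p $ 1 = b $ 1" "p $ 0 = 1"
      using oa_ex[OF oa, of 1 0 "b $ 1" 1] e n by auto
    obtain q where q: "q \<in> ?V" "q $ 1 = b $ 1" "q $ 2 = u $ 2"
      using oa_ex[OF oa, of 1 2 "b $ 1" "u $ 2"] e by auto
    obtain t where t: "t \<in> ?V" "t $ 1 = b $ 1" "t $ 2 = v $ 2"
      using oa_ex[OF oa, of 1 2 "b $ 1" "v $ 2"] e by auto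
    have "{w \<in> ?V. w $ 1 = b $ 1} \<subseteq> {b, p, q, t}"
    proof
      fix w assume "w \<in> {w \<in> ?V. w $ 1 = b $ 1}"
      then have w: "w \<in> ?V" "w $ 1 = b $ 1" by auto
      have "b \<rightarrow>\<^bsub>?G\<^esub> w" if "w \<noteq> b"
        using that w bV unfolding oa_adj[OF oa] by (intro conjI exI[of _ 1]) auto
      then have "w = b \<or> w \<notin> B" using no by blast
      then have "w = b \<or> w $ 0 = 1 \<or> w $ 2 = u $ 2 \<or> w $ 2 = v $ 2"
        using w bV u v by (auto simp: B_iff three_cases)
      then show "w \<in> {b, p, q, t}"
        using oa_eq[OF oa w(1) p(1), of 1 0] oa_eq[OF oa w(1) q(1), of 1 2]
          oa_eq[OF oa w(1) t(1), of 1 2] w p q t by auto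
    qed
    then have "card {w \<in> ?V. w $ 1 = b $ 1} \<le> card {b, p, q, t}" by (rule card_mono[rotated]) simp
    also have "\<dots> \<le> 4" by (simp add: card_insert_if)
    finally show False using oa_line[OF oa, of 1 "b $ 1"] e n by simp
  qed
  have "{u, v} \<union> B = ?V - S" "{u, v} \<inter> B = {}"
    using u v by (auto simp: B_def S_def nbhd_def)
  moreover have "\<forall>x\<in>{u, v}. \<forall>y\<in>B. \<not> x \<rightarrow>\<^bsub>?G\<^esub> y"
    by (auto simp: B_def S_def nbhd_def VG)
  moreover have "\<forall>x\<in>{u, v}. \<exists>y\<in>{u, v}. x \<rightarrow>\<^bsub>?G\<^esub> y" using uv G.graph_symmetric[OF uv] by auto
  ultimately have "disconnecting_set2 ?G S"
    unfolding disconnecting_set2_iff[OF oa_graph_graph[OF oa]] VG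
    using SV nb \<open>B \<noteq> {}\<close> by (intro conjI exI[of _ "{u, v}"] exI[of _ B]) auto
  with cS show ?thesis by blast
qed

text \<open>The four columns left over must form two edges with none between them. If
  \<open>c\<close>, \<open>d\<close> complete two columns \<open>x\<close>, \<open>y\<close> of a
  line to an intercalate, the other two columns \<open>u\<close>, \<open>v\<close> of the line form
  one edge and \<open>c\<close>, \<open>d\<close> the other.\<close>

lemma oa_ex_disconnecting_set2_eq4:
  assumes oa: "orthogonal_array3 4 M"
  shows "\<exists>S. disconnecting_set2 (oa_graph M) S \<and> card S = 12"
proof -
  let ?G = "oa_graph M" and ?V = "set (cols M)"
  interpret G: graph ?G by (rule oa_graph_graph[OF oa])
  have VG: "verts ?G = ?V" by (simp add: oa_graph_def)
  define L where "L = {v \<in> ?V. v $ 0 = 1}"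
  have LV: "x \<in> ?V" "x $ 0 = 1" if "x \<in> L" for x using that by (auto simp: L_def)
  have cL: "card L = 4" using oa_line[OF oa, of 0 1] by (simp add: L_def)
  have dist: "x $ i \<noteq> y $ i" if "x \<in> L" "y \<in> L" "x \<noteq> y" "i < 3" "i \<noteq> 0" for x y i
    using oa_eq[OF oa LV(1)[OF that(1)] LV(1)[OF that(2)], of 0 i] LV that by auto
  have "\<exists>w\<in>?V. w $ 1 = x $ 1 \<and> w $ 2 = y $ 2" if "x \<in> L" "y \<in> L" for x y
    using oa_ex[OF oa, of 1 2 "x $ 1" "y $ 2"] oa_entry[OF oa] LV that by auto
  then obtain q where q: "\<And>x y. x \<in> L \<Longrightarrow> y \<in> L \<Longrightarrow>
      q x y \<in> ?V \<and> q x y $ 1 = x $ 1 \<and> q x y $ 2 = y $ 2" by metis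
  have q0: "q x y $ 0 \<noteq> 1" if "x \<in> L" "y \<in> L" "x \<noteq> y" for x y
  proof
    assume "q x y $ 0 = 1"
    then have "q x y \<in> L" using q that by (simp add: L_def)
    then have "q x y = x" "q x y = y"
      using dist[of "q x y" x 1] dist[of "q x y" y 2] q[of x y] that by auto
    then show False using that by simp
  qed
  \<comment> \<open>The row and column conditions hold because columns agreeing in two rows
    coincide; \<open>q0\<close> excludes the symbol 1.\<close>
  obtain x y where xy: "x \<in> L" "y \<in> L" "x \<noteq> y" and sym: "q x y $ 0 = q y x $ 0"
  proof (rule four_point_symmetric_pair[OF cL, of "\<lambda>x y. q x y $ 0"])
    show "q x y $ 0 \<in> {2..4}" if "x \<in> L" "y \<in> L" "x \<noteq> y" for x y
      using q0[OF that] oa_entry[OF oa, of "q x y" 0] q[OF that(1,2)] by auto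
    show "q x y $ 0 \<noteq> q x z $ 0" if "x \<in> L" "y \<in> L" "z \<in> L" "x \<noteq> y" "x \<noteq> z" "y \<noteq> z" for x y z
      using oa_eq[OF oa, of "q x y" "q x z" 0 1] q[of x y] q[of x z] dist[of y z 2] that by auto
    show "q y x $ 0 \<noteq> q z x $ 0" if "x \<in> L" "y \<in> L" "z \<in> L" "x \<noteq> y" "x \<noteq> z" "y \<noteq> z" for x y z
      using oa_eq[OF oa, of "q y x" "q z x" 0 2] q[of y x] q[of z x] dist[of y z 1] that by auto
  qed
  define c d where "c = q x y" and "d = q y x"
  have c: "c \<in> ?V" "c $ 0 \<noteq> 1" "c $ 1 = x $ 1" "c $ 2 = y $ 2"
    and d: "d \<in> ?V" "d $ 0 \<noteq> 1" "d $ 1 = y $ 1" "d $ 2 = x $ 2"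
    using q q0 xy by (auto simp: c_def d_def)
  have "card (L - {x, y}) = 2" using cL xy by (simp add: card_Diff_subset)
  then obtain u v where uv: "L - {x, y} = {u, v}" "u \<noteq> v" by (auto simp: card_2_iff)
  have u: "u \<in> L" "u \<noteq> x" "u \<noteq> y" and v: "v \<in> L" "v \<noteq> x" "v \<noteq> y" using uv(1) by auto
  have "u \<rightarrow>\<^bsub>?G\<^esub> v"
    using uv(2) LV u(1) v(1) unfolding oa_adj[OF oa] by (intro conjI exI[of _ 0]) auto
  moreover have cd: "c $ 0 = d $ 0" "c \<noteq> d"
    using sym c(3) d(3) dist[OF xy, of 1] by (auto simp: c_def d_def)
  then have "c \<rightarrow>\<^bsub>?G\<^esub> d"
    using c(1) d(1) unfolding oa_adj[OF oa] by (intro conjI exI[of _ 0]) auto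
  ultimately have adj: "u \<rightarrow>\<^bsub>?G\<^esub> v" "c \<rightarrow>\<^bsub>?G\<^esub> d" by blast+
  \<comment> \<open>In rows 1 and 2, \<open>c\<close> and \<open>d\<close> only use entries of
    \<open>x\<close> and \<open>y\<close>, which \<open>u\<close> and \<open>v\<close> avoid; in row
    0, \<open>u\<close> and \<open>v\<close> have entry 1, unlike \<open>c\<close> and
    \<open>d\<close>.\<close>
  have far: "w $ i \<noteq> c $ i \<and> w $ i \<noteq> d $ i" if "w \<in> {u, v}" "i < 3" for w i
  proof -
    have w: "w \<in> L" "w \<noteq> x" "w \<noteq> y" using that(1) u v by auto
    have "w $ j \<noteq> x $ j" "w $ j \<noteq> y $ j" if "j = 1 \<or> j = 2" for j
      using dist[OF w(1) xy(1) w(2), of j] dist[OF w(1) xy(2) w(3), of j] that by auto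
    then show ?thesis using that(2) LV(2)[OF w(1)] c d unfolding three_cases by metis
  qed
  have no: "\<not> w \<rightarrow>\<^bsub>?G\<^esub> z" if "w \<in> {u, v}" "z \<in> {c, d}" for w z
    using far[OF that(1)] that(2) by (auto simp: oa_adj[OF oa])
  have disj: "{u, v} \<inter> {c, d} = {}" using LV u v c d by auto
  define S where "S = ?V - {u, v, c, d}"
  have sub: "{u, v, c, d} \<subseteq> ?V" using LV u v c d by auto
  have "card {u, v, c, d} = 4" using disj uv(2) cd(2) by auto
  then have cS: "card S = 12"
    unfolding S_def using sub oa_card[OF oa] by (subst card_Diff_subset) auto
  have "S \<subseteq> ?V" "{u, v} \<union> {c, d} = ?V - S" using sub by (auto simp: S_def)
  moreover have "\<forall>w\<in>{u, v}. \<forall>z\<in>{c, d}. \<not> w \<rightarrow>\<^bsub>?G\<^esub> z" using no by blast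
  moreover have "\<forall>w\<in>{u, v}. \<exists>z\<in>{u, v}. w \<rightarrow>\<^bsub>?G\<^esub> z" using adj(1) G.graph_symmetric[OF adj(1)] by auto
  moreover have "\<forall>w\<in>{c, d}. \<exists>z\<in>{c, d}. w \<rightarrow>\<^bsub>?G\<^esub> z" using adj(2) G.graph_symmetric[OF adj(2)] by auto
  moreover have "{u, v} \<noteq> {}" "{c, d} \<noteq> {}" by simp_all
  ultimately have "disconnecting_set2 ?G S"
    unfolding disconnecting_set2_iff[OF oa_graph_graph[OF oa]] VG
    using disj by (intro conjI exI[of _ "{u, v}"] exI[of _ "{c, d}"]) assumption+
  with cS show ?thesis by blast
qed

lemma oa_ex_disconnecting_set2:
  assumes "orthogonal_array3 n M" "n \<ge> 4"
  shows "\<exists>S. disconnecting_set2 (oa_graph M) S \<and> card S = 5 * n - 8"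
proof (cases "n = 4")
  case True
  then show ?thesis using oa_ex_disconnecting_set2_eq4 assms(1) by simp
next
  case False
  then show ?thesis using oa_ex_disconnecting_set2_ge5 assms by simp
qed

section \<open>The value of \<open>kappa2\<close> and the extremal sets\<close>

theorem lemma9p1:
  fixes n k lam :: nat and M :: "nat mat"
    and G :: "(nat vec, nat vec \<times> nat vec) pre_digraph"
  assumes "n \<ge> 4"
    and "orthogonal_array3 n M"
    and "G = oa_graph M"
    and "k = 3 * (n - 1)"
    and "lam = n"
  shows "kappa2 G = 2 * k - lam - 2 \<and> 2 * k - lam - 2 = 5 * n - 8 \<and>
    (\<forall>S. disconnecting_set2 G S \<and> card S = 5 * n - 8 \<longrightarrow>
       (\<exists>u v. u \<rightarrow>\<^bsub>G\<^esub> v \<and> S = nbhd G {u, v}) \<or>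
       (\<exists>A \<pi> \<sigma> x y. \<pi> permutes {..<3} \<and> (\<forall>i<3. \<sigma> i permutes {1..n}) \<and>
          induces_clique G A \<and> card A = 4 \<and>
          relabel_col \<pi> \<sigma> ` A = {vec_of_list [1, x i, y i] | i :: nat. i \<in> {1..4}} \<and>
          S = nbhd G A))"
proof -
  note bound = oa_disconnecting_set2_bound[OF assms(2,1)]
  have "kappa2 (oa_graph M) = 5 * n - 8"
    unfolding kappa2_def
  proof (rule cInf_eq_minimum)
    show "5 * n - 8 \<in> card ` {S. disconnecting_set2 (oa_graph M) S}"
      using oa_ex_disconnecting_set2[OF assms(2,1)] by force
    show "5 * n - 8 \<le> c" if "c \<in> card ` {S. disconnecting_set2 (oa_graph M) S}" for c
      using that bound by blast
  qed
  moreover have "2 * k - lam - 2 = 5 * n - 8" using assms by simp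
  ultimately show ?thesis using bound unfolding assms(3) by presburger
qed

end
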